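(* Let $p\in[1,\infty]$ and let $(X,d)$ be a complete, $p$-convex, reflexive metric space. Then every measure $\mu\in\mathcal{P}_p(X)$ has a $p$-barycenter, i.e. the function $y\mapsto w_p(\mu,\delta_y)$ attains its minimum on $X$.
   Context: A midpoint of $x,y\in X$ is a point $m$ with $d(x,m)=d(y,m)=\frac12 d(x,y)$. $(X,d)$ admits midpoints if every pair of points has a midpoint; a complete such space is geodesic. For $a,b\ge0$ put $\mathcal{M}^p(a,b)=\left(\frac12a^p+\frac12b^p\right)^{1/p}$ for $p\in[1,\infty)$ and $\mathcal{M}^\infty(a,b)=\max\{a,b\}$. $(X,d)$ is $p$-convex if it admits midpoints and $d(m,z)\le\mathcal{M}^p(d(x,z),d(y,z))$ for all $x,y,z\in X$ and every midpoint $m$ of $x,y$. A set is convex if it contains every geodesic connecting any two of its points. $(X,d)$ is reflexive if for every directed set $I$ and every decreasing family $(C_i)_{i\in I}$ of non-empty bounded closed convex subsets ($C_i\subset C_j$ whenever $i>j$) one has $\bigcap_{i\in I}C_i\neq\varnothing$. For $p<\infty$, $\mathcal{P}_p(X)$ is the set of (Borel) probability measures $\mu$ on $X$ with $\int d(x,x_0)^pd\mu(x)<\infty$ for some $x_0\in X$, and $w_p$ is the $p$-Wasserstein distance, so that $w_p(\mu,\delta_y)=\left(\int d(x,y)^pd\mu(x)\right)^{1/p}$. $\mathcal{P}_\infty(X)$ is the set of probability measures with bounded support, and $w_\infty(\mu,\delta_y)=\sup_{x\in\operatorname{supp}\mu}d(x,y)$. *)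

theory Defs
  imports "HOL-Probability.Probability"
begin

section \<open>Midpoints, geodesics and \<open>p\<close>-convexity\<close>

definition is_midpoint :: "'a::metric_space \<Rightarrow> 'a \<Rightarrow> 'a \<Rightarrow> bool" where
  "is_midpoint m x y \<longleftrightarrow> dist x m = dist x y / 2 \<and> dist y m = dist x y / 2"

definition admits_midpoints :: "'a::metric_space itself \<Rightarrow> bool" where
  "admits_midpoints _ \<longleftrightarrow> (\<forall>x y :: 'a. \<exists>m. is_midpoint m x y)"

text \<open>Only used for \<open>1 \<le> p \<le> \<infinity>\<close> and nonnegative arguments, where
  \<open>0 powr q = 0\<close> (\<open>q > 0\<close>) is the intended value.\<close>

definition power_mean :: "ereal \<Rightarrow> real \<Rightarrow> real \<Rightarrow> real" where
  "power_mean p a b =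
     (if p = \<infinity> then max a b
      else (1/2 * a powr real_of_ereal p + 1/2 * b powr real_of_ereal p)
             powr (1 / real_of_ereal p))"

definition p_convex :: "ereal \<Rightarrow> 'a::metric_space itself \<Rightarrow> bool" where
  "p_convex p _ \<longleftrightarrow>
     admits_midpoints TYPE('a) \<and>
     (\<forall>x y z m :: 'a. is_midpoint m x y \<longrightarrow>
        dist m z \<le> power_mean p (dist x z) (dist y z))"

text \<open>Geodesics are minimizing and parametrized on \<open>[0,1]\<close> with constant speed.\<close>

definition geodesic :: "(real \<Rightarrow> 'a::metric_space) \<Rightarrow> 'a \<Rightarrow> 'a \<Rightarrow> bool" where
  "geodesic \<gamma> x y \<longleftrightarrow>
     \<gamma> 0 = x \<and> \<gamma> 1 = y \<and>
     (\<forall>s\<in>{0..1}. \<forall>t\<in>{0..1}. dist (\<gamma> s) (\<gamma> t) = \<bar>s - t\<bar> * dist x y)"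

definition geodesically_convex :: "'a::metric_space set \<Rightarrow> bool" where
  "geodesically_convex C \<longleftrightarrow>
     (\<forall>x\<in>C. \<forall>y\<in>C. \<forall>\<gamma>. geodesic \<gamma> x y \<longrightarrow> \<gamma> ` {0..1} \<subseteq> C)"


section \<open>Reflexivity\<close>

definition directed_set :: "'i set \<Rightarrow> ('i \<Rightarrow> 'i \<Rightarrow> bool) \<Rightarrow> bool" where
  "directed_set I le \<longleftrightarrow>
     I \<noteq> {} \<and> (\<forall>i\<in>I. le i i) \<and>
     (\<forall>i\<in>I. \<forall>j\<in>I. \<forall>k\<in>I. le i j \<longrightarrow> le j k \<longrightarrow> le i k) \<and>
     (\<forall>i\<in>I. \<forall>j\<in>I. \<exists>k\<in>I. le i k \<and> le j k)"

definition decreasing_family :: "'i set \<Rightarrow> ('i \<Rightarrow> 'i \<Rightarrow> bool) \<Rightarrow> ('i \<Rightarrow> 'b set) \<Rightarrow> bool" where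
  "decreasing_family I le C \<longleftrightarrow> (\<forall>i\<in>I. \<forall>j\<in>I. le j i \<longrightarrow> C i \<subseteq> C j)"

text \<open>A definition cannot quantify over all types of indices. Index sets are taken inside
  \<^typ>\<open>'a set\<close>; the lemma \<open>reflexive_spaceD\<close> below shows that families over directed sets in
  an arbitrary type are then covered, too.\<close>

definition reflexive_space :: "'a::metric_space itself \<Rightarrow> bool" where
  "reflexive_space _ \<longleftrightarrow>
     (\<forall>(I :: 'a set set) le (C :: 'a set \<Rightarrow> 'a set).
        directed_set I le \<longrightarrow>
        (\<forall>i\<in>I. C i \<noteq> {} \<and> bounded (C i) \<and> closed (C i) \<and> geodesically_convex (C i)) \<longrightarrow>
        decreasing_family I le C \<longrightarrow>
        (\<Inter>i\<in>I. C i) \<noteq> {})"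

lemma reflexive_spaceD:
  fixes I :: "'i set" and C :: "'i \<Rightarrow> 'a::metric_space set"
  assumes refl: "reflexive_space TYPE('a)"
    and dir: "directed_set I le"
    and C: "\<And>i. i \<in> I \<Longrightarrow>
      C i \<noteq> {} \<and> bounded (C i) \<and> closed (C i) \<and> geodesically_convex (C i)"
    and dec: "decreasing_family I le C"
  shows "(\<Inter>i\<in>I. C i) \<noteq> {}"
proof -
  let ?le = "\<lambda>A B :: 'a set. B \<subseteq> A"
  have "directed_set (C ` I) ?le"
    unfolding directed_set_def
  proof (intro conjI ballI impI)
    show "C ` I \<noteq> {}" using dir by (simp add: directed_set_def)
  next
    fix A B assume "A \<in> C ` I" "B \<in> C ` I"
    then obtain i j where ij: "i \<in> I" "j \<in> I" "A = C i" "B = C j" by blast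
    then obtain k where k: "k \<in> I" "le i k" "le j k"
      using dir unfolding directed_set_def by blast
    then have "C k \<subseteq> A" "C k \<subseteq> B"
      using dec ij unfolding decreasing_family_def by blast+
    with k(1) show "\<exists>D\<in>C ` I. D \<subseteq> A \<and> D \<subseteq> B" by blast
  qed auto
  moreover have "decreasing_family (C ` I) ?le (\<lambda>A. A)"
    by (simp add: decreasing_family_def)
  moreover have "\<forall>A\<in>C ` I. A \<noteq> {} \<and> bounded A \<and> closed A \<and> geodesically_convex A"
    using C by blast
  ultimately have "(\<Inter>A\<in>C ` I. A) \<noteq> {}"
    using refl[unfolded reflexive_space_def, THEN spec[of _ "C ` I"], THEN spec[of _ ?le],
      THEN spec[of _ "\<lambda>A. A"]] by (elim impE)
  then show ?thesis by simp
qed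


section \<open>Wasserstein distance and barycenters\<close>

definition measure_support :: "'b::topological_space measure \<Rightarrow> 'b set" where
  "measure_support M = {x. \<forall>U. open U \<longrightarrow> x \<in> U \<longrightarrow> emeasure M U > 0}"

text \<open>For \<open>p < \<infinity>\<close> the space of Borel probability measures with finite \<open>p\<close>-th moment, for
  \<open>p = \<infinity>\<close> the one of those with bounded support.\<close>

definition prob_measures :: "ereal \<Rightarrow> 'a::metric_space measure set" where
  "prob_measures p =
     {\<mu>. sets \<mu> = sets borel \<and> prob_space \<mu> \<and>
         (if p = \<infinity> then bounded (measure_support \<mu>)
          else \<exists>x0. (\<integral>\<^sup>+x. ennreal (dist x x0 powr real_of_ereal p) \<partial>\<mu>) < \<infinity>)}"

text \<open>Couplings live on the Borel sigma-algebra of the product space rather than on the product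
  sigma-algebra: if the space is not separable, the latter may be smaller and the distance need
  not be measurable with respect to it.\<close>

definition couplings :: "'a::metric_space measure \<Rightarrow> 'a measure \<Rightarrow> ('a \<times> 'a) measure set" where
  "couplings \<mu> \<nu> =
     {\<pi>. sets \<pi> = sets borel \<and> distr \<pi> borel fst = \<mu> \<and> distr \<pi> borel snd = \<nu>}"

text \<open>The power \<open>x\<^sup>r\<close> in \<open>[0,\<infinity>]\<close> for \<open>r > 0\<close>.\<close>

definition ennreal_powr :: "ennreal \<Rightarrow> real \<Rightarrow> ennreal" where
  "ennreal_powr x r = (if x = \<infinity> then \<infinity> else ennreal (enn2real x powr r))"

definition transport_cost :: "ereal \<Rightarrow> ('a::metric_space \<times> 'a) measure \<Rightarrow> ennreal" where
  "transport_cost p \<pi> =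
     (if p = \<infinity> then (SUP (x, y)\<in>measure_support \<pi>. ennreal (dist x y))
      else ennreal_powr (\<integral>\<^sup>+(x, y). ennreal (dist x y powr real_of_ereal p) \<partial>\<pi>)
             (1 / real_of_ereal p))"

definition wasserstein ::
    "ereal \<Rightarrow> 'a::metric_space measure \<Rightarrow> 'a measure \<Rightarrow> ennreal" where
  "wasserstein p \<mu> \<nu> = (INF \<pi>\<in>couplings \<mu> \<nu>. transport_cost p \<pi>)"

text \<open>The Dirac measure at \<open>y\<close> is \<^term>\<open>return borel y\<close>.\<close>

definition is_p_barycenter :: "ereal \<Rightarrow> 'a::metric_space measure \<Rightarrow> 'a \<Rightarrow> bool" where
  "is_p_barycenter p \<mu> y \<longleftrightarrow>
     (\<forall>z. wasserstein p \<mu> (return borel y) \<le> wasserstein p \<mu> (return borel z))"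


subsection \<open>Distance to a Dirac measure\<close>

lemma borel_measurable_Pair_const:
  "(\<lambda>x :: 'a::metric_space. (x, y :: 'a)) \<in> borel_measurable borel"
  by (intro borel_measurable_continuous_onI continuous_intros)

lemma borel_measurable_fst_metric:
  "(fst :: 'a::metric_space \<times> 'a \<Rightarrow> 'a) \<in> borel_measurable borel"
  by (intro borel_measurable_continuous_onI continuous_intros)

lemma borel_measurable_snd_metric:
  "(snd :: 'a::metric_space \<times> 'a \<Rightarrow> 'a) \<in> borel_measurable borel"
  by (intro borel_measurable_continuous_onI continuous_intros)

lemma couplings_return:
  fixes \<mu> :: "'a::metric_space measure"
  assumes sets: "sets \<mu> = sets borel" and "prob_space \<mu>"
  shows "couplings \<mu> (return borel y) = {distr \<mu> borel (\<lambda>x. (x, y))}"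
proof -
  interpret prob_space \<mu> by fact
  have meas: "(\<lambda>x. (x, y)) \<in> \<mu> \<rightarrow>\<^sub>M borel"
    using borel_measurable_Pair_const measurable_cong_sets[OF sets refl] by blast
  have 1: "distr (distr \<mu> borel (\<lambda>x. (x, y))) borel fst = \<mu>"
    using meas borel_measurable_fst_metric
    by (subst distr_distr) (auto simp: comp_def sets intro!: distr_id2)
  have 2: "distr (distr \<mu> borel (\<lambda>x. (x, y))) borel snd = return borel y"
  proof -
    have "distr (distr \<mu> borel (\<lambda>x. (x, y))) borel snd = distr \<mu> borel (\<lambda>_. y)"
      using meas borel_measurable_snd_metric by (subst distr_distr) (auto simp: comp_def)
    also have "\<dots> = return borel y"
    proof (rule measure_eqI)
      fix A assume "A \<in> sets (distr \<mu> borel (\<lambda>_. y))"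
      then show "emeasure (distr \<mu> borel (\<lambda>_. y)) A = emeasure (return borel y) A"
        by (cases "y \<in> A") (auto simp: emeasure_distr emeasure_space_1)
    qed simp
    finally show ?thesis .
  qed
  have 3: "\<pi> = distr \<mu> borel (\<lambda>x. (x, y))" if \<pi>: "\<pi> \<in> couplings \<mu> (return borel y)" for \<pi>
  proof (rule measure_eqI)
    have s: "sets \<pi> = sets borel" and f: "distr \<pi> borel fst = \<mu>"
      and g: "distr \<pi> borel snd = return borel y"
      using \<pi> by (auto simp: couplings_def)
    note [measurable_cong] = s
    note [measurable] = borel_measurable_fst_metric borel_measurable_snd_metric
      borel_measurable_Pair_const
    show "sets \<pi> = sets (distr \<mu> borel (\<lambda>x. (x, y)))" using s by simp
    have "AE x in distr \<pi> borel snd. x = y"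
      unfolding g by (subst AE_return) auto
    then have AE: "AE z in \<pi>. snd z = y"
      by (subst (asm) AE_distr_iff) auto
    fix A assume A: "A \<in> sets \<pi>"
    then have [measurable]: "A \<in> sets borel" using s by simp
    have sp: "space \<pi> = UNIV" using sets_eq_imp_space_eq[OF s] by simp
    have "emeasure (distr \<mu> borel (\<lambda>x. (x, y))) A = emeasure \<mu> ((\<lambda>x. (x, y)) -` A \<inter> space \<mu>)"
      using meas A s by (intro emeasure_distr) auto
    also have "\<dots> = emeasure (distr \<pi> borel fst) ((\<lambda>x. (x, y)) -` A)"
      using sets_eq_imp_space_eq[OF sets] f by simp
    also have "\<dots> = emeasure \<pi> (fst -` ((\<lambda>x. (x, y)) -` A) \<inter> space \<pi>)"
      using measurable_sets[OF borel_measurable_Pair_const, of A] A s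
      by (intro emeasure_distr) auto
    also have "\<dots> = emeasure \<pi> A"
    proof (rule emeasure_eq_AE)
      show "AE z in \<pi>. (z \<in> fst -` ((\<lambda>x. (x, y)) -` A) \<inter> space \<pi>) = (z \<in> A)"
        using AE by eventually_elim (auto simp: sp)
      have "(\<lambda>x. (x, y)) -` A \<in> sets borel"
        using measurable_sets[OF borel_measurable_Pair_const, of A] A s by auto
      then show "fst -` ((\<lambda>x. (x, y)) -` A) \<inter> space \<pi> \<in> sets \<pi>"
        by measurable
    qed (use A in auto)
    finally show "emeasure \<pi> A = emeasure (distr \<mu> borel (\<lambda>x. (x, y))) A" ..
  qed
  have "distr \<mu> borel (\<lambda>x. (x, y)) \<in> couplings \<mu> (return borel y)"
    unfolding couplings_def using 1 2 by simp
  with 3 show ?thesis by blast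
qed

lemma wasserstein_return:
  fixes \<mu> :: "'a::metric_space measure"
  assumes sets: "sets \<mu> = sets borel" and "prob_space \<mu>" and "p \<noteq> \<infinity>"
  shows "wasserstein p \<mu> (return borel y) =
    ennreal_powr (\<integral>\<^sup>+x. ennreal (dist x y powr real_of_ereal p) \<partial>\<mu>) (1 / real_of_ereal p)"
proof -
  have "(\<lambda>z :: 'a \<times> 'a. dist (fst z) (snd z)) \<in> borel_measurable borel"
    by (intro borel_measurable_continuous_onI continuous_intros)
  then have "(\<lambda>z :: 'a \<times> 'a. ennreal (dist (fst z) (snd z) powr real_of_ereal p))
      \<in> borel_measurable borel"
    by measurable
  moreover have "(\<lambda>x. (x, y)) \<in> \<mu> \<rightarrow>\<^sub>M borel"
    using borel_measurable_Pair_const measurable_cong_sets[OF sets refl] by blast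
  ultimately show ?thesis
    using assms by (simp add: wasserstein_def couplings_return transport_cost_def
      nn_integral_distr case_prod_beta)
qed

lemma wasserstein_return_infinity:
  fixes \<mu> :: "'a::metric_space measure"
  assumes sets: "sets \<mu> = sets borel" and "prob_space \<mu>"
  shows "wasserstein \<infinity> \<mu> (return borel y) = (SUP x\<in>measure_support \<mu>. ennreal (dist x y))"
proof -
  let ?\<pi> = "distr \<mu> borel (\<lambda>x. (x, y))"
  have sp: "space \<mu> = UNIV" using sets_eq_imp_space_eq[OF sets] by simp
  have meas: "(\<lambda>x. (x, y)) \<in> \<mu> \<rightarrow>\<^sub>M borel"
    using borel_measurable_Pair_const measurable_cong_sets[OF sets refl] by blast
  have em: "emeasure ?\<pi> U = emeasure \<mu> ((\<lambda>x. (x, y)) -` U)" if "open U" for U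
    using meas that by (subst emeasure_distr) (auto simp: sp)
  have "measure_support ?\<pi> = (\<lambda>x. (x, y)) ` measure_support \<mu>"
  proof (intro equalityI subsetI)
    fix z assume z: "z \<in> measure_support ?\<pi>"
    obtain x w where zxw: "z = (x, w)" by (cases z)
    have "w = y"
    proof (rule ccontr)
      assume "w \<noteq> y"
      then have "z \<in> UNIV \<times> (- {y})" "open (UNIV \<times> (- {y}) :: ('a \<times> 'a) set)"
        by (auto simp: zxw intro: open_Times)
      then have "emeasure ?\<pi> (UNIV \<times> (- {y})) > 0"
        using z unfolding measure_support_def by blast
      with em[OF \<open>open (UNIV \<times> (- {y}))\<close>] show False by (auto simp: vimage_def)
    qed
    moreover have "x \<in> measure_support \<mu>"
      unfolding measure_support_def
    proof (intro CollectI allI impI)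
      fix U assume "open U" "x \<in> U"
      then have "open (U \<times> (UNIV :: 'a set))" "z \<in> U \<times> UNIV"
        by (auto simp: zxw intro: open_Times)
      then have "emeasure ?\<pi> (U \<times> UNIV) > 0"
        using z unfolding measure_support_def by blast
      with em[OF \<open>open (U \<times> UNIV)\<close>] show "emeasure \<mu> U > 0" by (auto simp: vimage_def)
    qed
    ultimately show "z \<in> (\<lambda>x. (x, y)) ` measure_support \<mu>" using zxw by blast
  next
    fix z assume "z \<in> (\<lambda>x. (x, y)) ` measure_support \<mu>"
    then obtain x where x: "x \<in> measure_support \<mu>" "z = (x, y)" by blast
    show "z \<in> measure_support ?\<pi>"
      unfolding measure_support_def
    proof (intro CollectI allI impI)
      fix U assume U: "open U" "z \<in> U"
      have "open ((\<lambda>x. (x, y)) -` U)"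
        using U(1) by (intro open_vimage continuous_intros)
      moreover have "x \<in> (\<lambda>x. (x, y)) -` U" using U x by simp
      ultimately show "emeasure ?\<pi> U > 0"
        using x(1) em[OF U(1)] unfolding measure_support_def by auto
    qed
  qed
  then show ?thesis
    using assms by (simp add: wasserstein_def couplings_return transport_cost_def image_image)
qed

end

theory Submission
  imports Defs
begin

text \<open>
  The function \<open>y \<mapsto> \<integral> d(x,y)\<^sup>p d\<mu>(x)\<close> (respectively the supremum of \<open>d(x,y)\<close> over the
  support) is lower semicontinuous by Fatou's lemma, quasiconvex along midpoints by
  \<open>p\<close>-convexity, and its finite sublevel sets are bounded by the triangle inequality. A closed
  midpoint-convex set is geodesically convex, so the finite sublevel sets, which form a chain,
  have a common point by reflexivity; such a point is a minimizer.
\<close>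

section \<open>Closed midpoint-convex sets are geodesically convex\<close>

text \<open>For \<open>t\<close> between \<open>a\<close> and \<open>b\<close>, take the points of
  \<open>T\<close> nearest to \<open>t\<close> from the left and from the right; closedness makes
  them exist. Their midpoint lies in \<open>T\<close> on one side of \<open>t\<close> and cannot be
  nearer than the nearest point there, so the two coincide with \<open>t\<close>.\<close>

lemma midpoint_closed_imp_interval_subset:
  fixes T :: "real set"
  assumes T: "closed T" "a \<in> T" "b \<in> T"
    and mid: "\<And>s t. s \<in> T \<Longrightarrow> t \<in> T \<Longrightarrow> (s + t) / 2 \<in> T"
  shows "{a..b} \<subseteq> T"
proof
  fix t assume t: "t \<in> {a..b}"
  let ?L = "T \<inter> {a..t}" and ?R = "T \<inter> {t..b}"
  have bdd: "bdd_above ?L" "bdd_below ?R" by auto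
  have l: "Sup ?L \<in> ?L"
    using T t bdd by (intro closed_contains_Sup) auto
  have r: "Inf ?R \<in> ?R"
    using T t bdd by (intro closed_contains_Inf) auto
  let ?m = "(Sup ?L + Inf ?R) / 2"
  have m: "?m \<in> T" using l r mid by blast
  show "t \<in> T"
  proof (cases "?m \<le> t")
    case True
    then have "?m \<le> Sup ?L" using l r m bdd by (intro cSup_upper) auto
    then have "Sup ?L = t" using l r by auto
    then show ?thesis using l by auto
  next
    case False
    then have "Inf ?R \<le> ?m" using l r m bdd by (intro cInf_lower) auto
    then have "Inf ?R = t" using l r by auto
    then show ?thesis using r by auto
  qed
qed

lemma geodesic_midpoint:
  assumes "geodesic \<gamma> x y" "s \<in> {0..1}" "t \<in> {0..1}"
  shows "is_midpoint (\<gamma> ((s + t) / 2)) (\<gamma> s) (\<gamma> t)"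
proof -
  have "(s + t) / 2 \<in> {0..1}" using assms by auto
  moreover have "\<bar>s - (s + t) / 2\<bar> = \<bar>s - t\<bar> / 2" "\<bar>t - (s + t) / 2\<bar> = \<bar>s - t\<bar> / 2"
    by (auto simp: abs_if field_simps)
  ultimately show ?thesis
    using assms unfolding geodesic_def is_midpoint_def by simp
qed

lemma continuous_on_geodesic:
  assumes "geodesic \<gamma> x y"
  shows "continuous_on {0..1} \<gamma>"
proof -
  have "(dist x y)-lipschitz_on {0..1} \<gamma>"
    using assms by (intro lipschitz_onI) (auto simp: geodesic_def dist_real_def mult.commute)
  then show ?thesis by (rule lipschitz_on_continuous_on)
qed

text \<open>Along a geodesic, midpoints of parameters give midpoints of points. So the parameters
  with values in \<open>C\<close> form a closed, midpoint-stable subset of [0,1] containing both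
  ends, hence all of it.\<close>

lemma closed_midpoint_convex_imp_geodesically_convex:
  fixes C :: "'a::metric_space set"
  assumes "closed C"
    and mid: "\<And>x y m. x \<in> C \<Longrightarrow> y \<in> C \<Longrightarrow> is_midpoint m x y \<Longrightarrow> m \<in> C"
  shows "geodesically_convex C"
  unfolding geodesically_convex_def
proof (intro ballI allI impI)
  fix x y \<gamma> assume xy: "x \<in> C" "y \<in> C" and \<gamma>: "geodesic \<gamma> x y"
  let ?T = "{0..1} \<inter> \<gamma> -` C"
  have "{0..1} \<subseteq> ?T"
  proof (rule midpoint_closed_imp_interval_subset)
    show "closed ?T"
      using continuous_on_geodesic[OF \<gamma>] \<open>closed C\<close> by (intro continuous_closed_preimage) auto
    show "0 \<in> ?T" "1 \<in> ?T" using xy \<gamma> by (auto simp: geodesic_def)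
    show "(s + t) / 2 \<in> ?T" if "s \<in> ?T" "t \<in> ?T" for s t
      using that mid[OF _ _ geodesic_midpoint[OF \<gamma>, of s t]] by auto
  qed
  then show "\<gamma> ` {0..1} \<subseteq> C" by auto
qed

section \<open>Minimization by reflexivity\<close>

text \<open>Any common point of the sublevel sets at the levels \<open>F z\<close> is a minimizer
  over \<open>P\<close>. The predicate \<open>P\<close> allows discarding levels, such as infinite
  ones, whose sublevel sets may be unbounded.\<close>

lemma reflexive_space_attains_min:
  fixes F :: "'a::metric_space \<Rightarrow> 'b::linorder"
  assumes refl: "reflexive_space TYPE('a)"
    and z0: "P z0"
    and closed: "\<And>z. P z \<Longrightarrow> closed {y. F y \<le> F z}"
    and bounded: "\<And>z. P z \<Longrightarrow> bounded {y. F y \<le> F z}"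
    and mid: "\<And>x y m. is_midpoint m x y \<Longrightarrow> F m \<le> max (F x) (F y)"
  shows "\<exists>y. \<forall>z. P z \<longrightarrow> F y \<le> F z"
proof -
  have "(\<Inter>z\<in>Collect P. {y. F y \<le> F z}) \<noteq> {}"
  proof (rule reflexive_spaceD[OF refl])
    \<comment> \<open>Points serve as indices, and a smaller value counts as a later index. By
      linearity of the order on values, one of any two indices dominates both.\<close>
    show "directed_set (Collect P) (\<lambda>z w. F w \<le> F z)"
      unfolding directed_set_def using z0 by (auto intro: order.trans) (metis linear order_refl)
    show "decreasing_family (Collect P) (\<lambda>z w. F w \<le> F z) (\<lambda>z. {y. F y \<le> F z})"
      unfolding decreasing_family_def by auto
    fix z assume z: "z \<in> Collect P"
    have "geodesically_convex {y. F y \<le> F z}"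
      using closed[of z] z
      by (intro closed_midpoint_convex_imp_geodesically_convex) (auto dest!: mid simp: le_max_iff_disj)
    then show "{y. F y \<le> F z} \<noteq> {} \<and> bounded {y. F y \<le> F z} \<and> closed {y. F y \<le> F z} \<and>
        geodesically_convex {y. F y \<le> F z}"
      using closed bounded z by auto
  qed
  then show ?thesis by auto
qed

section \<open>Finite exponents: moments of the distance\<close>

lemma ennreal_powr_mono:
  assumes "x \<le> y" "0 \<le> r"
  shows "ennreal_powr x r \<le> ennreal_powr y r"
  using assms by (auto simp: ennreal_powr_def top.not_eq_extremum
    intro!: ennreal_leI powr_mono2 enn2real_mono split: if_splits dest: top.extremum_uniqueI)

lemma powr_dist_midpoint_le:
  fixes x y z m :: "'a::metric_space"
  assumes conv: "p_convex (ereal r) TYPE('a)" and r: "1 \<le> r" and m: "is_midpoint m x y"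
  shows "dist m z powr r \<le> (dist x z powr r + dist y z powr r) / 2"
proof -
  let ?S = "1/2 * dist x z powr r + 1/2 * dist y z powr r"
  have "dist m z \<le> ?S powr (1 / r)"
    using conv m unfolding p_convex_def power_mean_def by fastforce
  then have "dist m z powr r \<le> (?S powr (1 / r)) powr r"
    using r by (intro powr_mono2) auto
  also have "\<dots> = ?S" using r by (simp add: powr_powr)
  finally show ?thesis by simp
qed

text \<open>Bounding the sum by twice the maximum gives a crude constant, which is enough for
  boundedness.\<close>

lemma powr_add_le_two_powr:
  fixes a b r :: real
  assumes "0 \<le> a" "0 \<le> b" "0 \<le> r"
  shows "(a + b) powr r \<le> 2 powr r * (a powr r + b powr r)"
proof -
  have "(a + b) powr r \<le> (2 * max a b) powr r"
    using assms by (intro powr_mono2) auto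
  also have "\<dots> = 2 powr r * max a b powr r"
    using assms by (intro powr_mult)
  also have "\<dots> \<le> 2 powr r * (a powr r + b powr r)"
    by (intro mult_left_mono) (auto simp: max_def)
  finally show ?thesis .
qed

text \<open>The distance to a Dirac measure before taking the root. Minimizing it minimizes the
  distance, and it can be estimated by integrating pointwise inequalities.\<close>

definition moment :: "real \<Rightarrow> 'a::metric_space measure \<Rightarrow> 'a \<Rightarrow> ennreal" where
  "moment r \<mu> y = (\<integral>\<^sup>+x. ennreal (dist x y powr r) \<partial>\<mu>)"

lemma measurable_dist_powr:
  fixes \<mu> :: "'a::metric_space measure"
  assumes "sets \<mu> = sets borel"
  shows "(\<lambda>x. ennreal (dist x y powr r)) \<in> borel_measurable \<mu>"
proof -
  have "(\<lambda>x. dist x y) \<in> borel_measurable borel"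
    by (intro borel_measurable_continuous_onI continuous_intros)
  then have "(\<lambda>x. ennreal (dist x y powr r)) \<in> borel_measurable borel"
    by measurable
  then show ?thesis using measurable_cong_sets[OF assms refl] by blast
qed

text \<open>The integrands are nonnegative and converge pointwise along a convergent sequence of
  centers, so Fatou's lemma carries the bound \<open>c\<close> to the limit.\<close>

lemma closed_moment_sublevel:
  fixes \<mu> :: "'a::metric_space measure"
  assumes sets: "sets \<mu> = sets borel" and r: "0 < r"
  shows "closed {y. moment r \<mu> y \<le> c}"
  unfolding closed_sequential_limits
proof (intro allI impI, elim conjE)
  fix u l assume u: "\<forall>n. u n \<in> {y. moment r \<mu> y \<le> c}" and lim: "u \<longlonglongrightarrow> l"
  have "liminf (\<lambda>n. ennreal (dist x (u n) powr r)) = ennreal (dist x l powr r)" for x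
  proof (intro lim_imp_Liminf tendsto_ennrealI)
    show "(\<lambda>n. dist x (u n) powr r) \<longlonglongrightarrow> dist x l powr r"
      using r by (intro tendsto_powr2 tendsto_dist tendsto_const lim) auto
  qed simp
  then have "moment r \<mu> l = (\<integral>\<^sup>+x. liminf (\<lambda>n. ennreal (dist x (u n) powr r)) \<partial>\<mu>)"
    unfolding moment_def by simp
  also have "\<dots> \<le> liminf (\<lambda>n. moment r \<mu> (u n))"
    unfolding moment_def by (intro nn_integral_liminf measurable_dist_powr sets)
  also have "\<dots> \<le> c"
    using u by (intro Liminf_le) auto
  finally show "l \<in> {y. moment r \<mu> y \<le> c}" by simp
qed

text \<open>Two points of the sublevel set are compared through a \<open>\<mu>\<close>-random point
  \<open>x\<close>: the triangle inequality, raised to the power \<open>r\<close> and integrated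
  over \<open>x\<close>, bounds their distance by their moments.\<close>

lemma bounded_moment_sublevel:
  fixes \<mu> :: "'a::metric_space measure"
  assumes sets: "sets \<mu> = sets borel" and "prob_space \<mu>" and r: "0 < r" and c: "c < \<infinity>"
  shows "bounded {y. moment r \<mu> y \<le> c}"
proof (cases "\<exists>x0. moment r \<mu> x0 \<le> c")
  case True
  then obtain x0 where x0: "moment r \<mu> x0 \<le> c" ..
  interpret prob_space \<mu> by fact
  define B where "B = enn2real (ennreal (2 powr r) * (c + c))"
  have "ennreal (2 powr r) * (c + c) < \<infinity>"
    using c by (simp add: ennreal_mult_less_top)
  then have B: "ennreal (2 powr r) * (c + c) = ennreal B"
    unfolding B_def by simp
  have "dist x0 y \<le> B powr (1 / r)" if y: "moment r \<mu> y \<le> c" for y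
  proof -
    \<comment> \<open>The integrand is constant in \<open>x\<close> and the total mass is
      one.\<close>
    have "ennreal (dist x0 y powr r) = (\<integral>\<^sup>+x. ennreal (dist x0 y powr r) \<partial>\<mu>)"
      by (simp add: emeasure_space_1)
    also have "\<dots> \<le> (\<integral>\<^sup>+x. ennreal (2 powr r) *
        (ennreal (dist x x0 powr r) + ennreal (dist x y powr r)) \<partial>\<mu>)"
    proof (rule nn_integral_mono)
      fix x
      have "dist x0 y powr r \<le> (dist x x0 + dist x y) powr r"
        using r dist_triangle3[of x0 y x] by (intro powr_mono2) auto
      also have "\<dots> \<le> 2 powr r * (dist x x0 powr r + dist x y powr r)"
        using r by (intro powr_add_le_two_powr) auto
      finally show "ennreal (dist x0 y powr r) \<le> ennreal (2 powr r) *
          (ennreal (dist x x0 powr r) + ennreal (dist x y powr r))"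
        by (simp flip: ennreal_plus ennreal_mult)
    qed
    also have "\<dots> = ennreal (2 powr r) * (moment r \<mu> x0 + moment r \<mu> y)"
      unfolding moment_def using measurable_dist_powr[OF sets]
      by (simp add: nn_integral_cmult nn_integral_add)
    also have "\<dots> \<le> ennreal (2 powr r) * (c + c)"
      using x0 y by (intro mult_left_mono add_mono) auto
    finally have "dist x0 y powr r \<le> B"
      unfolding B by (simp add: B_def)
    then have "(dist x0 y powr r) powr (1 / r) \<le> B powr (1 / r)"
      using r by (intro powr_mono2) auto
    then show ?thesis using r by (simp add: powr_powr)
  qed
  then show ?thesis by (auto simp: bounded_def)
next
  case False
  then show ?thesis by simp
qed

lemma moment_midpoint_le:
  fixes \<mu> :: "'a::metric_space measure"
  assumes sets: "sets \<mu> = sets borel"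
    and conv: "p_convex (ereal r) TYPE('a)" and r: "1 \<le> r" and m: "is_midpoint m x y"
  shows "moment r \<mu> m \<le> max (moment r \<mu> x) (moment r \<mu> y)"
proof -
  let ?M = "max (moment r \<mu> x) (moment r \<mu> y)"
  have "moment r \<mu> m \<le> (\<integral>\<^sup>+z. ennreal (1/2) *
      (ennreal (dist z x powr r) + ennreal (dist z y powr r)) \<partial>\<mu>)"
    unfolding moment_def
  proof (rule nn_integral_mono)
    fix z
    have "dist z m powr r \<le> 1/2 * (dist z x powr r + dist z y powr r)"
      using powr_dist_midpoint_le[OF conv r m, of z] by (simp add: dist_commute)
    then have "ennreal (dist z m powr r) \<le> ennreal (1/2 * (dist z x powr r + dist z y powr r))"
      by (rule ennreal_leI)
    also have "\<dots> = ennreal (1/2) * (ennreal (dist z x powr r) + ennreal (dist z y powr r))"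
      by (subst ennreal_mult) auto
    finally show "ennreal (dist z m powr r) \<le> ennreal (1/2) *
        (ennreal (dist z x powr r) + ennreal (dist z y powr r))" .
  qed
  also have "\<dots> = ennreal (1/2) * (moment r \<mu> x + moment r \<mu> y)"
    unfolding moment_def using measurable_dist_powr[OF sets]
    by (simp add: nn_integral_cmult nn_integral_add)
  \<comment> \<open>The average is at most the maximum, also when a moment is infinite.\<close>
  also have "\<dots> \<le> ennreal (1/2) * (?M + ?M)"
    by (intro mult_left_mono add_mono) auto
  also have "\<dots> = ennreal (1/2) * ennreal 2 * ?M"
    by (simp add: mult_2[symmetric] mult.assoc)
  also have "ennreal (1/2) * ennreal 2 = 1"
    by (subst ennreal_mult[symmetric]) simp_all
  finally show ?thesis by simp
qed

lemma ex_barycenter_finite: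
  fixes \<mu> :: "'a::metric_space measure"
  assumes r: "1 \<le> r" and conv: "p_convex (ereal r) TYPE('a)"
    and refl: "reflexive_space TYPE('a)" and \<mu>: "\<mu> \<in> prob_measures (ereal r)"
  shows "\<exists>y. is_p_barycenter (ereal r) \<mu> y"
proof -
  from \<mu> have sets: "sets \<mu> = sets borel" and prob: "prob_space \<mu>"
    and "\<exists>x0. moment r \<mu> x0 < \<infinity>"
    by (auto simp: prob_measures_def moment_def)
  then obtain x0 where x0: "moment r \<mu> x0 < \<infinity>" by blast
  have "\<exists>y. \<forall>z. moment r \<mu> z < \<infinity> \<longrightarrow> moment r \<mu> y \<le> moment r \<mu> z"
    using r sets prob
    by (intro reflexive_space_attains_min[OF refl, of _ x0] x0 closed_moment_sublevel
      bounded_moment_sublevel moment_midpoint_le[OF _ conv]) auto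
  then obtain y where "\<And>z. moment r \<mu> z < \<infinity> \<Longrightarrow> moment r \<mu> y \<le> moment r \<mu> z" by blast
  \<comment> \<open>Points of infinite moment were left out of the minimization, but the inequality
    is trivial there.\<close>
  then have "moment r \<mu> y \<le> moment r \<mu> z" for z
    by (cases "moment r \<mu> z < \<infinity>") (auto simp: not_less top_unique)
  then have "is_p_barycenter (ereal r) \<mu> y"
    using r unfolding is_p_barycenter_def wasserstein_return[OF sets prob PInfty_neq_ereal(1)[of r]]
    by (auto simp flip: moment_def intro!: ennreal_powr_mono)
  then show ?thesis ..
qed

section \<open>The exponent \<open>\<infinity>\<close>: suprema over the support\<close>

text \<open>
  On a nonseparable space the support of a Borel probability measure may be empty. Then the
  distance \<open>w\<^sub>\<infinity>\<close> vanishes and every point is a barycenter.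
\<close>

lemma ex_barycenter_infinity:
  fixes \<mu> :: "'a::metric_space measure"
  assumes conv: "p_convex \<infinity> TYPE('a)"
    and refl: "reflexive_space TYPE('a)" and \<mu>: "\<mu> \<in> prob_measures \<infinity>"
  shows "\<exists>y. is_p_barycenter \<infinity> \<mu> y"
proof -
  from \<mu> have sets: "sets \<mu> = sets borel" and prob: "prob_space \<mu>"
    and bdd: "bounded (measure_support \<mu>)"
    by (auto simp: prob_measures_def)
  define S where "S = measure_support \<mu>"
  define F where "F y = (SUP x\<in>S. ennreal (dist x y))" for y
  have F: "wasserstein \<infinity> \<mu> (return borel y) = F y" for y
    using wasserstein_return_infinity[OF sets prob] by (simp add: F_def S_def)
  show ?thesis
  proof (cases "S = {}")
    case True
    then show ?thesis by (simp add: is_p_barycenter_def F F_def)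
  next
    case False
    then obtain x0 where x0: "x0 \<in> S" by blast
    have F_finite: "F z < \<infinity>" for z
    proof -
      obtain e where "\<And>x. x \<in> S \<Longrightarrow> dist z x \<le> e"
        using bdd unfolding S_def bounded_any_center[of _ z] by blast
      then have "F z \<le> ennreal e"
        unfolding F_def by (intro SUP_least ennreal_leI) (simp add: dist_commute)
      then show ?thesis by (simp add: le_less_trans)
    qed
    have "\<exists>y. \<forall>z. True \<longrightarrow> F y \<le> F z"
    proof (rule reflexive_space_attains_min[OF refl])
      fix z
      obtain c where c: "F z = ennreal c" "0 \<le> c"
        using F_finite[of z] by (cases "F z") auto
      \<comment> \<open>As an intersection of closed balls around the points of the support, the
        sublevel set is closed; it is bounded because at least one ball, that around
        \<open>x0\<close>, occurs.\<close>
      have eq: "{y. F y \<le> F z} = (\<Inter>x\<in>S. cball x c)"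
        using c by (auto simp: F_def SUP_le_iff)
      show "closed {y. F y \<le> F z}" unfolding eq by auto
      show "bounded {y. F y \<le> F z}"
        unfolding eq using x0 by (auto intro: bounded_subset[OF bounded_cball])
    next
      fix x y m :: 'a assume m: "is_midpoint m x y"
      show "F m \<le> max (F x) (F y)"
        unfolding F_def[of m]
      proof (rule SUP_least)
        fix z assume z: "z \<in> S"
        have "dist z m \<le> max (dist z x) (dist z y)"
          using conv m unfolding p_convex_def power_mean_def
          by (simp add: dist_commute[of z])
        then have "ennreal (dist z m) \<le> max (ennreal (dist z x)) (ennreal (dist z y))"
          by (auto simp: le_max_iff_disj)
        also have "\<dots> \<le> max (F x) (F y)"
          unfolding F_def using z by (intro max.mono SUP_upper)
        finally show "ennreal (dist z m) \<le> max (F x) (F y)" .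
      qed
    qed simp
    then show ?thesis by (simp add: is_p_barycenter_def F)
  qed
qed

theorem theorem36:
  fixes p :: ereal and \<mu> :: "'a::complete_space measure"
  assumes "1 \<le> p"
    and "p_convex p TYPE('a)"
    and "reflexive_space TYPE('a)"
    and "\<mu> \<in> prob_measures p"
  shows "\<exists>y. is_p_barycenter p \<mu> y"
proof (cases p)
  case (real r)
  then show ?thesis using assms ex_barycenter_finite[of r \<mu>] by simp
next
  case PInf
  then show ?thesis using assms ex_barycenter_infinity[of \<mu>] by simp
next
  case MInf
  then show ?thesis using assms by simp
qed

end
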